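(* The function $f:(0,\infty)\to(0,\infty)$ defined by $f(x)=\frac{1}{\arctan x}$ is logarithmically completely monotonic on $(0,\infty)$.
   Context: A function $f:(0,\infty)\to(0,\infty)$ is called logarithmically completely monotonic (on $(0,\infty)$) if it is infinitely differentiable and $(-1)^n(\log f)^{(n)}(x)\ge 0$ for all $x>0$ and all integers $n\ge 1$, where $(\log f)^{(n)}$ denotes the $n$-th derivative of $x\mapsto \log f(x)$. Here $\arctan$ is the usual real arctangent with values in $(-\pi/2,\pi/2)$. *)

theory Defs
  imports "HOL-Analysis.Analysis"
begin

text \<open>
  A function on \<open>(0,\<infinity>)\<close> is represented by a total function on the reals of which only the
  values on the open half-line \<open>{0<..}\<close> matter: since \<open>{0<..}\<close> is open, the iterated derivatives
  \<open>(deriv ^^ n) f x\<close> at points \<open>x > 0\<close> do not depend on the values of \<open>f\<close> outside it.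
  \<open>deriv\<close> is total, so differentiability of every order has to be required explicitly.
\<close>

definition infinitely_differentiable_on_pos :: "(real \<Rightarrow> real) \<Rightarrow> bool" where
  "infinitely_differentiable_on_pos f \<longleftrightarrow>
     (\<forall>n. \<forall>x>0. ((deriv ^^ n) f) differentiable (at x))"

definition logarithmically_completely_monotonic :: "(real \<Rightarrow> real) \<Rightarrow> bool" where
  "logarithmically_completely_monotonic f \<longleftrightarrow>
     (\<forall>x>0. f x > 0) \<and>
     infinitely_differentiable_on_pos f \<and>
     (\<forall>n\<ge>1. \<forall>x>0. (-1) ^ n * (deriv ^^ n) (\<lambda>t. ln (f t)) x \<ge> 0)"

end

theory Submission
  imports Defs "HOL-Complex_Analysis.Residue_Theorem"
begin

text \<open>
  Since \<open>(- ln (arctan x))' = - 1 / ((1 + x\<^sup>2) arctan x)\<close>, it suffices that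
  \<open>g x = 1 / ((1 + x\<^sup>2) arctan x)\<close> is completely monotonic. With \<open>\<theta> = arctan x\<close>, the residue theorem
  for \<open>cos\<^sup>2 \<theta> sin\<^sup>2 z / (z (sin\<^sup>2 z - sin\<^sup>2 \<theta>))\<close> on the rectangles
  \<open>[-\<pi>/2, \<pi>/2] \<times> [-R, R]\<close>, \<open>R \<rightarrow> \<infinity>\<close>, gives
  \<open>2 g x = \<integral> 1 / (x (1 + x\<^sup>2 tanh\<^sup>2 c)) \<cdot> 1 / (\<pi>\<^sup>2/4 + c\<^sup>2) dc\<close> over the real line.
  With \<open>y = 1 / tanh c\<close>, the kernel is \<open>1 / x - Re (1 / (x + i y))\<close>. Expanded at \<open>x = a - h\<close> in powers
  of \<open>h\<close>, it has the coefficients \<open>1 / a\<^sup>n\<^sup>+\<^sup>1 - Re (1 / (a + i y)\<^sup>n\<^sup>+\<^sup>1)\<close>, which are nonnegative because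
  \<open>\<bar>a + i y\<bar> \<ge> a\<close>; hence so are the coefficients of \<open>g (a - h)\<close>.
\<close>

section \<open>Residues of the kernel in the rectangle\<close>

text \<open>The singularity at 0 is removable, because the numerator vanishes there. The two simple
  poles at \<theta> and -\<theta> contribute equally. Continuity on the boundary is recorded so that
  the contour integral can later be split along the sides.\<close>

lemma arctan_kernel_residues:
  fixes \<theta> R :: real
  defines "f \<equiv> \<lambda>z::complex. of_real (cos \<theta>) ^ 2 * sin z ^ 2 / (z * (sin z ^ 2 - of_real (sin \<theta>) ^ 2))"
  assumes \<theta>: "0 < \<theta>" "\<theta> < pi / 2" and R: "R > 0"
  shows "contour_integral (rectpath (Complex (-pi/2) (-R)) (Complex (pi/2) R)) f
           = 2 * pi * \<i> * of_real (sin \<theta> * cos \<theta> / \<theta>)"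
    and "z \<in> path_image (rectpath (Complex (-pi/2) (-R)) (Complex (pi/2) R)) \<Longrightarrow> isCont f z"
proof -
  \<comment> \<open>The zeros of \<open>sin z ^ 2 - sin \<theta> ^ 2\<close> are the points n*pi +
    \<theta> and n*pi - \<theta>. This strip is bounded by the zeros next to \<theta> and -\<theta>,
    so it contains only these two; it contains the rectangle because \<theta> < pi/2.\<close>
  define S where "S = {z::complex. Re z > \<theta> - pi} \<inter> {z. Re z < pi - \<theta>}"
  define pts where "pts = {0, of_real \<theta>, - of_real \<theta> :: complex}"
  let ?\<gamma> = "rectpath (Complex (-pi/2) (-R)) (Complex (pi/2) R)"
  let ?D = "\<lambda>z::complex. sin z ^ 2 - of_real (sin \<theta>) ^ 2"
  have opS: "open S" "convex S"
    unfolding S_def by (auto intro!: open_Int open_halfspace_Re_gt open_halfspace_Re_lt convex_Int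
        convex_halfspace_Re_gt convex_halfspace_Re_lt)
  have mem: "0 \<in> S" "of_real \<theta> \<in> S" "- of_real \<theta> \<in> S"
    using \<theta> by (auto simp: S_def)
  have D_eq: "?D z = sin (z + of_real \<theta>) * sin (z - of_real \<theta>)" for z
  proof -
    have *: "cos z ^ 2 = 1 - sin z ^ 2" for z :: complex
      by (simp add: cos_squared_eq)
    show ?thesis
      unfolding sin_add sin_diff
      by (simp add: algebra_simps power_mult_distrib * flip: sin_of_real cos_of_real)
         (simp add: * algebra_simps flip: power2_eq_square mult.assoc)
  qed
  have int_zero: "n = 0" if "- pi < n * pi" "n * pi < pi" for n :: int
    using that mult_less_cancel_right_pos[OF pi_gt_zero, of "-1" n]
      mult_less_cancel_right_pos[OF pi_gt_zero, of n 1] by simp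
  have nz: "?D z \<noteq> 0" if "z \<in> S" "z \<noteq> of_real \<theta>" "z \<noteq> - of_real \<theta>" for z
  proof
    assume "?D z = 0"
    then consider "sin (z + of_real \<theta>) = 0" | "sin (z - of_real \<theta>) = 0"
      unfolding D_eq by auto
    then show False
    proof cases
      case 1
      then obtain n :: int where "z + of_real \<theta> = of_real (n * pi)" using sin_eq_0 by blast
      then have z: "z = of_real (n * pi - \<theta>)" by (simp add: algebra_simps)
      then have "Re z = n * pi - \<theta>" by (simp only: Re_complex_of_real)
      moreover have "\<theta> - pi < Re z" "Re z < pi - \<theta>" using that(1) by (auto simp: S_def)
      ultimately have "- pi < n * pi" "n * pi < pi" using \<theta> by linarith+
      then have "n = 0" by (rule int_zero)
      with z that show False by simp
    next
      case 2
      then obtain n :: int where "z - of_real \<theta> = of_real (n * pi)" using sin_eq_0 by blast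
      then have z: "z = of_real (n * pi + \<theta>)" by (simp add: algebra_simps)
      then have "Re z = n * pi + \<theta>" by (simp only: Re_complex_of_real)
      moreover have "\<theta> - pi < Re z" "Re z < pi - \<theta>" using that(1) by (auto simp: S_def)
      ultimately have "- pi < n * pi" "n * pi < pi" using \<theta> by linarith+
      then have "n = 0" by (rule int_zero)
      with z that show False by simp
    qed
  qed
  have holo: "f holomorphic_on S - pts"
    unfolding f_def pts_def using nz by (auto intro!: holomorphic_intros)
  have sub: "path_image ?\<gamma> \<subseteq> S - pts"
    using \<theta> R by (auto simp: path_image_rectpath S_def pts_def)
  show "isCont f z" if "z \<in> path_image ?\<gamma>"
  proof -
    have "open (S - pts)" using opS by (intro open_Diff finite_imp_closed) (auto simp: pts_def)
    then show ?thesis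
      using holomorphic_on_imp_continuous_on[OF holo] sub that
      by (auto simp: continuous_on_eq_continuous_at)
  qed
  have wind: "winding_number ?\<gamma> p = 1" if "p \<in> pts" for p
    using that \<theta> R by (intro winding_number_rectpath) (auto simp: pts_def in_box_complex_iff)
  have Dderiv: "(?D has_field_derivative 2 * sin z * cos z) (at z)" for z
    by (auto intro!: derivative_eq_intros)
  have sc: "sin \<theta> \<noteq> 0" "cos \<theta> \<noteq> 0"
    using \<theta> sin_gt_zero[of \<theta>] cos_gt_zero_pi[of \<theta>] by auto
  have res0: "residue f 0 = 0"
  proof -
    let ?S = "S - {of_real \<theta>, - of_real \<theta>}"
    have "residue (\<lambda>w. (of_real (cos \<theta>) ^ 2 * sin w ^ 2 / ?D w) / (w - 0)) 0
            = of_real (cos \<theta>) ^ 2 * sin 0 ^ 2 / ?D 0"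
    proof (rule residue_simple[of ?S])
      show "open ?S" using opS by (intro open_Diff) auto
      show "0 \<in> ?S" using mem \<theta> by auto
      show "(\<lambda>w. of_real (cos \<theta>) ^ 2 * sin w ^ 2 / ?D w) holomorphic_on ?S"
        using nz by (auto intro!: holomorphic_intros)
    qed
    then show ?thesis by (simp add: f_def mult.commute)
  qed
  have resp: "residue f p = of_real (sin \<theta> * cos \<theta> / (2 * \<theta>))"
    if p: "p = of_real \<theta> \<or> p = - of_real \<theta>" for p
  proof -
    have pS: "p \<in> S" "p \<noteq> 0" using p mem \<theta> by auto
    then obtain e where e: "e > 0" "ball p e \<subseteq> S - {0}"
      using opS by (metis open_contains_ball open_delete Diff_iff singletonD)
    \<comment> \<open>Passing from \<theta> to -\<theta> changes the sign of both
      \<open>1 / p\<close> and \<open>sin p\<close>, hence the common value of the two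
      residues.\<close>
    have "residue (\<lambda>w. (of_real (cos \<theta>) ^ 2 * sin w ^ 2 / w) / ?D w) p
            = (of_real (cos \<theta>) ^ 2 * sin p ^ 2 / p) / (2 * sin p * cos p)"
    proof (rule residue_simple_pole_deriv[of _ "ball p e"])
      show "(\<lambda>w. of_real (cos \<theta>) ^ 2 * sin w ^ 2 / w) holomorphic_on ball p e"
        using e by (auto intro!: holomorphic_intros)
      show "?D holomorphic_on ball p e" by (intro holomorphic_intros)
      show "(?D has_field_derivative 2 * sin p * cos p) (at p)" by (rule Dderiv)
    qed (use e p sc pS \<theta> in \<open>auto simp: sin_of_real cos_of_real\<close>)
    also have "\<dots> = of_real (sin \<theta> * cos \<theta> / (2 * \<theta>))"
      using p sc \<theta> by (auto simp: sin_of_real cos_of_real field_simps power2_eq_square)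
    finally show ?thesis by (simp add: f_def mult.commute)
  qed
  have "contour_integral ?\<gamma> f = 2 * pi * \<i> * (\<Sum>p\<in>pts. winding_number ?\<gamma> p * residue f p)"
  proof (rule Residue_theorem[OF opS(1) convex_connected[OF opS(2)] _ holo _ _ sub])
    show "\<forall>z. z \<notin> S \<longrightarrow> winding_number ?\<gamma> z = 0"
      using \<theta> R by (intro allI impI winding_number_rectpath_outside)
        (auto simp: S_def in_cbox_complex_iff)
  qed (auto simp: pts_def)
  also have "(\<Sum>p\<in>pts. winding_number ?\<gamma> p * residue f p) = (\<Sum>p\<in>pts. residue f p)"
    by (rule sum.cong[OF refl]) (simp only: wind mult_1)
  also have "\<dots> = of_real (sin \<theta> * cos \<theta> / \<theta>)"
    using \<theta> by (auto simp: pts_def res0 resp complex_eq_iff field_simps)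
  finally show "contour_integral ?\<gamma> f = 2 * pi * \<i> * of_real (sin \<theta> * cos \<theta> / \<theta>)" .
qed

section \<open>From the rectangle to an integral over the real line\<close>

text \<open>Nonnegativity makes the truncations to [-n, n] increase with n, so monotone convergence
  yields integrability and the value together from the limit alone.\<close>

lemma has_bochner_integral_limit_Icc:
  fixes f :: "real \<Rightarrow> real"
  assumes cont: "continuous_on UNIV f" and nonneg: "\<And>x. f x \<ge> 0"
    and lim: "(\<lambda>n. integral {- real n..real n} f) \<longlonglongrightarrow> L"
  shows "has_bochner_integral lborel f L"
proof (rule has_bochner_integral_monotone_convergence)
  let ?f = "\<lambda>n x. indicator {- real n..real n} x *\<^sub>R f x"
  have int: "set_integrable lborel {- real n..real n} f" for n
    by (intro borel_integrable_atLeastAtMost' continuous_on_subset[OF cont]) auto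
  show "integrable lborel (?f n)" for n
    using int[of n] by (simp add: set_integrable_def)
  show "AE x in lborel. mono (\<lambda>n. ?f n x)"
    by (auto intro!: monoI simp: indicator_def nonneg)
  have "eventually (\<lambda>n. ?f n x = f x) sequentially" for x
  proof -
    have "\<forall>\<^sub>F n in sequentially. \<bar>x\<bar> \<le> real n"
      using filterlim_real_sequentially by (simp add: filterlim_at_top)
    then show ?thesis by eventually_elim (auto simp: indicator_def)
  qed
  then show "AE x in lborel. (\<lambda>n. ?f n x) \<longlonglongrightarrow> f x"
    by (simp add: tendsto_eventually)
  show "(\<lambda>n. integral\<^sup>L lborel (?f n)) \<longlonglongrightarrow> L"
    using lim set_borel_integral_eq_integral(2)[OF int] by (simp add: set_lebesgue_integral_def)
  show "f \<in> borel_measurable lborel"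
    using borel_measurable_continuous_onI[OF cont] by simp
qed

text \<open>On both vertical sides \<open>sin z ^ 2\<close> is therefore the real number
  \<open>cosh c ^ 2\<close>, and the kernels there differ only through the factor 1/z.\<close>

lemma sin_vertical:
  "sin (Complex (pi / 2) c) = of_real (cosh c)" "sin (Complex (- pi / 2) c) = - of_real (cosh c)"
proof -
  have *: "Complex a c = of_real a + \<i> * of_real c" for a by (simp add: complex_eq_iff)
  have [simp]: "cos (\<i> * of_real c) = of_real (cosh c)"
    by (simp add: complex_eq_iff cosh_def Re_cos Im_cos field_simps)
  show "sin (Complex (pi / 2) c) = of_real (cosh c)" "sin (Complex (- pi / 2) c) = - of_real (cosh c)"
    unfolding * sin_add by (simp_all flip: sin_of_real cos_of_real)
qed

lemma norm_sin_squared_ge: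
  assumes "\<bar>Im z\<bar> \<ge> 3"
  shows "norm (sin z) ^ 2 \<ge> 3"
proof -
  \<comment> \<open>Since exp 3 is at least 1 + 3 = 4, its square is at least 16, and the norm
    squared is at least (16 - 2)/4, which exceeds 3.\<close>
  have "16 \<le> exp (2 * \<bar>Im z\<bar>)"
  proof -
    have "4 \<le> exp \<bar>Im z\<bar>" using exp_ge_add_one_self[of "\<bar>Im z\<bar>"] assms by linarith
    then have "4 ^ 2 \<le> exp \<bar>Im z\<bar> ^ 2" by (rule power_mono) auto
    then show ?thesis by (simp add: exp_double)
  qed
  moreover have "norm (sin z) ^ 2 * 4 = exp (2 * Im z) + inverse (exp (2 * Im z)) - 2 * cos (2 * Re z)"
    unfolding norm_sin_squared by simp
  moreover have "exp (2 * \<bar>Im z\<bar>) \<le> exp (2 * Im z) + inverse (exp (2 * Im z))"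
    by (cases "Im z \<ge> 0") (auto simp flip: exp_minus)
  ultimately show ?thesis
    using cos_le_one[of "2 * Re z"] by linarith
qed

lemma norm_kernel_le:
  fixes \<theta> R :: real
  assumes R: "R \<ge> 3" and z: "\<bar>Im z\<bar> = R"
  shows "norm (of_real (cos \<theta>) ^ 2 * sin z ^ 2 / (z * (sin z ^ 2 - of_real (sin \<theta>) ^ 2))) \<le> 2 / R"
proof -
  define s where "s = norm (sin z) ^ 2"
  have s: "s \<ge> 3" using norm_sin_squared_ge R z by (simp add: s_def)
  have "norm (sin z ^ 2) - norm (of_real (sin \<theta>) ^ 2 :: complex) \<le> norm (sin z ^ 2 - of_real (sin \<theta>) ^ 2)"
    by (rule norm_triangle_ineq2)
  moreover have "norm (of_real (sin \<theta>) ^ 2 :: complex) \<le> 1"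
    using abs_sin_le_one by (simp add: norm_power abs_square_le_1)
  ultimately have D: "s - 1 \<le> norm (sin z ^ 2 - of_real (sin \<theta>) ^ 2)"
    by (simp add: s_def norm_power)
  have nz: "R \<le> norm z" using abs_Im_le_cmod[of z] z by simp
  have "R * (s - 1) \<le> norm z * norm (sin z ^ 2 - of_real (sin \<theta>) ^ 2)"
    using D nz R s by (intro mult_mono) auto
  then have "cos \<theta> ^ 2 * s / (norm z * norm (sin z ^ 2 - of_real (sin \<theta>) ^ 2)) \<le> 1 * s / (R * (s - 1))"
    using R s by (intro frac_le mult_right_mono) (auto simp: abs_square_le_1)
  \<comment> \<open>The ratio s/(s - 1) is at most 2 as soon as s is at least 2.\<close>
  also have "\<dots> \<le> 2 / R"
    using R s by (simp add: field_simps)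
  finally show ?thesis
    by (simp add: norm_divide norm_mult norm_power s_def)
qed

text \<open>The difference equals \<open>cos \<theta> ^ 2 + sinh c ^ 2\<close>.\<close>

lemma kernel_denominator_pos:
  fixes \<theta> c :: real
  assumes "0 < \<theta>" "\<theta> < pi / 2"
  shows "cosh c ^ 2 - sin \<theta> ^ 2 > 0"
proof -
  have "cos \<theta> > 0" using assms by (intro cos_gt_zero_pi) auto
  then have "cos \<theta> ^ 2 + sinh c ^ 2 > 0" by (intro add_pos_nonneg) auto
  then show ?thesis by (simp add: cos_squared_eq cosh_square_eq algebra_simps)
qed

lemma kernel_continuous:
  fixes \<theta> :: real
  assumes "0 < \<theta>" "\<theta> < pi / 2"
  shows "continuous_on UNIV (\<lambda>c. cos \<theta> ^ 2 * cosh c ^ 2 / (cosh c ^ 2 - sin \<theta> ^ 2) / (pi ^ 2 / 4 + c ^ 2))"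
proof -
  have "pi ^ 2 / 4 + c ^ 2 \<noteq> 0" for c :: real
    using add_pos_nonneg[of "pi ^ 2 / 4" "c ^ 2"] by auto
  then show ?thesis
    using kernel_denominator_pos[OF assms] by (intro continuous_intros) (auto simp: less_le)
qed

text \<open>The vertical sides together give i*pi times the integral of \<open>k\<close>, and each
  horizontal side, of length pi, gives at most 2*pi/R. Comparing with the residue value and dividing
  by pi leaves 4/R.\<close>

lemma kernel_integral_bound:
  fixes \<theta> R :: real
  defines "k \<equiv> \<lambda>c. cos \<theta> ^ 2 * cosh c ^ 2 / (cosh c ^ 2 - sin \<theta> ^ 2) / (pi ^ 2 / 4 + c ^ 2)"
  assumes \<theta>: "0 < \<theta>" "\<theta> < pi / 2" and R: "R \<ge> 3"
  shows "\<bar>integral {-R..R} k - 2 * sin \<theta> * cos \<theta> / \<theta>\<bar> \<le> 4 / R"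
proof -
  let ?f = "\<lambda>z::complex. of_real (cos \<theta>) ^ 2 * sin z ^ 2 / (z * (sin z ^ 2 - of_real (sin \<theta>) ^ 2))"
  define a where "a = Complex (- pi / 2) (- R)"
  define b where "b = Complex (pi / 2) (- R)"
  define c where "c = Complex (pi / 2) R"
  define d where "d = Complex (- pi / 2) R"
  have rect: "rectpath a c = linepath a b +++ linepath b c +++ linepath c d +++ linepath d a"
    by (simp add: rectpath_def Let_def a_def b_def c_def d_def)
  have "isCont ?f z" if "z \<in> path_image (rectpath a c)" for z
    using arctan_kernel_residues(2)[of \<theta> R z] that \<theta> R by (simp add: a_def c_def)
  then have "continuous_on (path_image (rectpath a c)) ?f"
    by (rule continuous_at_imp_continuous_on[rule_format])
  then have cont: "continuous_on (closed_segment a b) ?f" "continuous_on (closed_segment b c) ?f"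
      "continuous_on (closed_segment c d) ?f" "continuous_on (closed_segment d a) ?f"
    unfolding rect by (auto simp: path_image_join intro: continuous_on_subset)
  note int = cont[THEN contour_integrable_continuous_linepath]
  define I where "I = (\<lambda>p. contour_integral p ?f)"
  define J where "J = (\<lambda>r. integral {-R..R} (\<lambda>x. ?f (Complex r x)))"
  have "I (rectpath a c) = I (linepath a b) + I (linepath b c) + I (linepath c d) + I (linepath d a)"
    unfolding rect I_def by (simp add: int contour_integrable_join add.assoc)
  moreover have "I (linepath b c) = \<i> * J (pi / 2)"
    unfolding I_def J_def
    using R by (intro contour_integral_linepath_same_Re) (auto simp: b_def c_def)
  moreover have "I (linepath d a) = - I (linepath a d)"
    unfolding I_def using cont(4) by (rule contour_integral_reverse_linepath)
  moreover have "I (linepath a d) = \<i> * J (- pi / 2)"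
    unfolding I_def J_def
    using R by (intro contour_integral_linepath_same_Re) (auto simp: a_def d_def)
  \<comment> \<open>The right side runs upwards and the left side downwards, so their integrals
    enter with opposite signs; the two factors 1/z combine to
    \<open>pi / (pi ^ 2 / 4 + x ^ 2)\<close>.\<close>
  moreover have "J (pi / 2) - J (- pi / 2) = of_real (pi * integral {-R..R} k)"
  proof -
    have i: "(\<lambda>x. ?f (Complex r x)) integrable_on {-R..R}" if "\<bar>r\<bar> = pi / 2" for r
    proof (rule integrable_continuous_real)
      have *: "(\<lambda>x. Complex r x) ` {-R..R} \<subseteq> path_image (rectpath a c)"
        using that R by (auto simp: path_image_rectpath a_def c_def abs_if split: if_splits)
      show "continuous_on {-R..R} (\<lambda>x. ?f (Complex r x))"
        by (rule continuous_on_compose2[OF \<open>continuous_on (path_image (rectpath a c)) ?f\<close> _ *])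
           (auto simp: Complex_eq intro!: continuous_intros)
    qed
    have "?f (Complex (pi / 2) x) - ?f (Complex (- pi / 2) x) = of_real (pi * k x)" for x
    proof -
      have nz: "Complex (pi / 2) x \<noteq> 0" "Complex (- pi / 2) x \<noteq> 0" by (auto simp: complex_eq_iff)
      have "1 / Complex (pi / 2) x - 1 / Complex (- pi / 2) x = of_real (pi / (pi ^ 2 / 4 + x ^ 2))"
      proof -
        have "Complex (pi / 2) x * Complex (- pi / 2) x = - of_real (pi ^ 2 / 4 + x ^ 2)"
          by (simp add: complex_eq_iff power2_eq_square)
        moreover have "Complex (- pi / 2) x - Complex (pi / 2) x = - of_real pi"
          by (simp add: complex_eq_iff)
        ultimately show ?thesis by (simp only: diff_frac_eq[OF nz] mult_1 minus_divide_divide of_real_divide)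
      qed
      moreover have "?f (Complex (pi / 2) x) - ?f (Complex (- pi / 2) x)
          = of_real (cos \<theta> ^ 2 * cosh x ^ 2 / (cosh x ^ 2 - sin \<theta> ^ 2)) * (1 / Complex (pi / 2) x - 1 / Complex (- pi / 2) x)"
      proof -
        have *: "A / (u * D) - A / (v * D) = A / D * (1 / u - 1 / v)" for A D u v :: complex
          by (simp add: right_diff_distrib mult.commute)
        show ?thesis unfolding sin_vertical power2_minus * by simp
      qed
      ultimately show ?thesis by (simp add: k_def)
    qed
    then have "J (pi / 2) - J (- pi / 2) = integral {-R..R} (\<lambda>x. of_real (pi * k x))"
      using i[of "pi / 2"] i[of "- pi / 2"]
      by (simp add: J_def flip: Henstock_Kurzweil_Integration.integral_diff)
    also have "\<dots> = of_real (integral {-R..R} (\<lambda>x. pi * k x))"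
    proof (intro integral_unique has_integral_of_real integrable_integral integrable_continuous_real)
      show "continuous_on {-R..R} (\<lambda>x. pi * k x)"
        unfolding k_def by (intro continuous_on_mult_left continuous_on_subset[OF kernel_continuous[OF \<theta>]]) auto
    qed
    finally show ?thesis by simp
  qed
  moreover have "I (rectpath a c) = 2 * pi * \<i> * of_real (sin \<theta> * cos \<theta> / \<theta>)"
    unfolding a_def c_def I_def using \<theta> R by (intro arctan_kernel_residues(1)) auto
  ultimately have eq: "\<i> * of_real (pi * (integral {-R..R} k - 2 * sin \<theta> * cos \<theta> / \<theta>))
      = - I (linepath a b) - I (linepath c d)"
    by (simp add: algebra_simps)
  have "pi * \<bar>integral {-R..R} k - 2 * sin \<theta> * cos \<theta> / \<theta>\<bar>
      = norm (\<i> * of_real (pi * (integral {-R..R} k - 2 * sin \<theta> * cos \<theta> / \<theta>)))"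
    unfolding norm_mult norm_of_real abs_mult by simp
  also have "\<dots> \<le> norm (I (linepath a b)) + norm (I (linepath c d))"
    unfolding eq using norm_triangle_ineq4[of "- I (linepath a b)"] by simp
  also have "\<dots> \<le> 2 / R * norm (b - a) + 2 / R * norm (d - c)"
    unfolding I_def
  proof (intro add_mono contour_integral_bound_linepath int norm_kernel_le R)
    show "\<bar>Im z\<bar> = R" if "z \<in> closed_segment a b" for z
      using that R by (auto simp: closed_segment_same_Im a_def b_def)
    show "\<bar>Im z\<bar> = R" if "z \<in> closed_segment c d" for z
      using that R by (auto simp: closed_segment_same_Im c_def d_def)
  qed (use R in auto)
  also have "\<dots> = pi * (4 / R)"
    using R by (simp add: a_def b_def c_def d_def cmod_eq_Re field_simps)
  finally show ?thesis by (rule mult_left_le_imp_le) simp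
qed

section \<open>Iterated derivatives of power series and of restrictions of holomorphic
  functions\<close>

text \<open>Termwise differentiation, iterated. The induction carries the expansion on the whole
  disc, since each derivative depends on values near the point.\<close>

lemma powser_higher_deriv:
  fixes f :: "'a :: {real_normed_field,banach} \<Rightarrow> 'a"
  assumes "\<And>z. norm z < r \<Longrightarrow> (\<lambda>n. c n * z ^ n) sums f (a + z)" "norm z < r"
  shows "(\<lambda>n. (diffs ^^ k) c n * z ^ n) sums (deriv ^^ k) f (a + z)"
proof -
  let ?P = "\<lambda>c f. \<forall>z. norm z < r \<longrightarrow> (\<lambda>n. c n * z ^ n) sums f (a + z)"
  have step: "(f has_field_derivative (\<Sum>n. diffs c n * z ^ n)) (at (a + z))"
    if c: "?P c f" and z: "norm z < r" for c :: "nat \<Rightarrow> 'a" and f z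
  proof -
    have "((\<lambda>z. \<Sum>n. c n * z ^ n) has_field_derivative (\<Sum>n. diffs c n * z ^ n)) (at z)"
      using c z by (intro termdiffs_strong'[of r]) (auto intro: sums_summable)
    moreover have ev: "eventually (\<lambda>z. (\<Sum>n. c n * z ^ n) = f (a + z)) (nhds z)"
      using eventually_nhds_in_open[of "ball 0 r" z] z c
      by (auto elim!: eventually_mono simp: sums_iff)
    ultimately have "((\<lambda>z. f (a + z)) has_field_derivative (\<Sum>n. diffs c n * z ^ n)) (at z)"
      using DERIV_cong_ev[OF refl ev refl] by simp
    then show ?thesis
      using DERIV_shift[of f _ z a] by (simp add: add.commute)
  qed
  have P_step: "?P (diffs c) (deriv f)" if c: "?P c f" for c :: "nat \<Rightarrow> 'a" and f
  proof (intro allI impI)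
    fix z :: 'a assume z: "norm z < r"
    have "(f has_field_derivative deriv f (a + z)) (at (a + z))"
      using step[OF c z] DERIV_imp_deriv by fastforce
    then have "((\<lambda>z. f (a + z)) has_field_derivative deriv f (a + z)) (at z)"
      using DERIV_shift[of f _ z a] by (simp add: add.commute)
    then show "(\<lambda>n. diffs c n * z ^ n) sums deriv f (a + z)"
      using c z by (intro termdiffs_sums_strong[of r c "\<lambda>z. f (a + z)"]) auto
  qed
  have P: "?P ((diffs ^^ k) c) ((deriv ^^ k) f)"
    by (induction k) (use assms(1) P_step in auto)
  then show ?thesis
    using assms(2) by auto
qed

text \<open>\<open>diffs\<close> moves the coefficient of index \<open>Suc n\<close> to index
  \<open>n\<close> with a positive factor, so the sign at \<open>n\<close> after \<open>k\<close>
  steps is that of the original index \<open>n + k\<close>.\<close>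

lemma funpow_diffs_alternating:
  fixes c :: "nat \<Rightarrow> real"
  assumes "\<And>n. (-1) ^ n * c n \<le> 0"
  shows "(-1) ^ (n + k) * (diffs ^^ k) c n \<le> 0"
proof (induction k arbitrary: n)
  case (Suc k)
  have "(-1) ^ (n + Suc k) * (diffs ^^ Suc k) c n
          = real (Suc n) * ((-1) ^ (Suc n + k) * (diffs ^^ k) c (Suc n))"
    by (simp add: diffs_def)
  then show ?case using Suc[of "Suc n"] by (simp only: mult_nonneg_nonpos of_nat_0_le_iff)
qed (use assms in simp)

text \<open>Expanding in h = a - x absorbs the alternating signs: (-1)^k times the k-th derivative
  at \<open>a\<close> is k! times \<open>B k\<close>.\<close>

lemma powser_alternating_derivs:
  fixes g :: "real \<Rightarrow> real"
  assumes "r > 0" and B: "\<And>n. B n \<le> 0" and "\<And>h. \<bar>h\<bar> < r \<Longrightarrow> (\<lambda>n. B n * h ^ n) sums g (a - h)"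
  shows "(-1) ^ k * (deriv ^^ k) g a \<le> 0"
proof -
  define c where "c n = (-1) ^ n * B n" for n
  have c: "(\<lambda>n. c n * z ^ n) sums g (a + z)" if "norm z < r" for z
    using assms(3)[of "-z"] that by (simp add: c_def power_minus' mult_ac power_minus[of z])
  from powser_higher_deriv[of r c g a 0 k] c \<open>r > 0\<close>
  have "(\<lambda>n. (diffs ^^ k) c n * 0 ^ n) sums (deriv ^^ k) g a" by simp
  then have "(deriv ^^ k) g a = (diffs ^^ k) c 0" by (simp add: powser_sums_zero_iff)
  moreover have "(-1) ^ (0 + k) * (diffs ^^ k) c 0 \<le> 0"
    by (rule funpow_diffs_alternating) (simp add: c_def B flip: mult.assoc power_mult_distrib)
  ultimately show ?thesis by simp
qed

text \<open>Along the real axis, differentiation commutes with taking real parts, so a holomorphic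
  extension makes the real function smooth. Openness of \<open>S\<close> keeps the identity valid
  near each point, as the induction on the order requires.\<close>

lemma Re_higher_deriv:
  fixes F :: "complex \<Rightarrow> complex" and f :: "real \<Rightarrow> real"
  assumes S: "open S" "F holomorphic_on S" and x: "of_real x \<in> S"
    and f: "\<And>x. of_real x \<in> S \<Longrightarrow> f x = Re (F (of_real x))"
  shows "(deriv ^^ n) f x = Re ((deriv ^^ n) F (of_real x))"
    and "(deriv ^^ n) f differentiable (at x)"
proof -
  have op: "open (of_real -` S :: real set)"
    using S(1) by (intro continuous_open_vimage continuous_intros) auto
  have step: "(g has_field_derivative Re (deriv G (of_real x))) (at x)"
    if "G holomorphic_on S" "of_real x \<in> S"
      "\<And>x. of_real x \<in> S \<Longrightarrow> g x = Re (G (of_real x))" for g :: "real \<Rightarrow> real" and G x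
  proof -
    have "(G has_field_derivative deriv G (of_real x)) (at (of_real x))"
      using that S(1) holomorphic_derivI by blast
    then have "((\<lambda>x. G (of_real x)) has_vector_derivative deriv G (of_real x)) (at x)"
      by (rule has_vector_derivative_real_field)
    then have "((\<lambda>x. Re (G (of_real x))) has_field_derivative Re (deriv G (of_real x))) (at x)"
      by (simp add: has_vector_derivative_complex_iff)
    then show ?thesis
      by (rule has_field_derivative_transform_within_open[OF _ op]) (use that in auto)
  qed
  have *: "(deriv ^^ n) f x = Re ((deriv ^^ n) F (of_real x))" if "of_real x \<in> S" for x
    using that
  proof (induction n arbitrary: x)
    case (Suc n)
    have "(deriv ^^ n) F holomorphic_on S" using S by (intro holomorphic_higher_deriv)
    from step[OF this Suc.prems Suc.IH] show ?case by (simp add: DERIV_imp_deriv)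
  qed (simp add: f)
  show "(deriv ^^ n) f x = Re ((deriv ^^ n) F (of_real x))" using * x .
  have "(deriv ^^ n) F holomorphic_on S" using S by (intro holomorphic_higher_deriv)
  from step[OF this x *] show "(deriv ^^ n) f differentiable (at x)"
    using real_differentiable_def by blast
qed

section \<open>The integral representation and the expansion of its kernel\<close>

lemma has_bochner_integral_kernel:
  fixes \<theta> :: real
  assumes \<theta>: "0 < \<theta>" "\<theta> < pi / 2"
  shows "has_bochner_integral lborel
           (\<lambda>c. cos \<theta> ^ 2 * cosh c ^ 2 / (cosh c ^ 2 - sin \<theta> ^ 2) / (pi ^ 2 / 4 + c ^ 2))
           (2 * sin \<theta> * cos \<theta> / \<theta>)" (is "has_bochner_integral _ ?k ?L")
proof (rule has_bochner_integral_limit_Icc)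
  show "continuous_on UNIV ?k" by (rule kernel_continuous[OF \<theta>])
  show "?k c \<ge> 0" for c
    using kernel_denominator_pos[OF \<theta>, of c] by (intro divide_nonneg_nonneg) auto
  have "eventually (\<lambda>n. norm (integral {- real n..real n} ?k - ?L) \<le> 4 / real n) sequentially"
    using eventually_ge_at_top[of 3] by eventually_elim (use kernel_integral_bound[OF \<theta>] in simp)
  moreover have "(\<lambda>n. 4 / real n) \<longlonglongrightarrow> 0" by (rule lim_const_over_n)
  ultimately have "(\<lambda>n. integral {- real n..real n} ?k - ?L) \<longlonglongrightarrow> 0"
    by (rule Lim_null_comparison)
  then show "(\<lambda>n. integral {- real n..real n} ?k) \<longlonglongrightarrow> ?L" by (rule LIM_zero_cancel)
qed

text \<open>Put \<theta> = arctan x. Then \<open>cosh c ^ 2 - sin \<theta> ^ 2\<close> equals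
  \<open>cosh c ^ 2 * (1 + x ^ 2 * tanh c ^ 2) / (1 + x ^ 2)\<close>, and the factors
  \<open>cosh c ^ 2\<close> and \<open>1 + x ^ 2\<close> cancel.\<close>

lemma arctan_integral_representation:
  fixes x :: real
  assumes x: "x > 0"
  shows "has_bochner_integral lborel (\<lambda>c. 1 / (1 + x ^ 2 * tanh c ^ 2) / (pi ^ 2 / 4 + c ^ 2))
           (2 * x / ((1 + x ^ 2) * arctan x))"
proof -
  define \<theta> where "\<theta> = arctan x"
  have \<theta>: "0 < \<theta>" "\<theta> < pi / 2" using x arctan_ubound by (auto simp: \<theta>_def)
  have p: "1 + x ^ 2 > 0" by (intro add_pos_nonneg) auto
  have cos2: "cos \<theta> ^ 2 = 1 / (1 + x ^ 2)" using p by (simp add: \<theta>_def cos_arctan power_divide)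
  have sin2: "sin \<theta> ^ 2 = x ^ 2 / (1 + x ^ 2)" using p by (simp add: \<theta>_def sin_arctan power_divide)
  have sc: "sin \<theta> * cos \<theta> = x / (1 + x ^ 2)" using p by (simp add: \<theta>_def sin_arctan cos_arctan)
  have "cos \<theta> ^ 2 * cosh c ^ 2 / (cosh c ^ 2 - sin \<theta> ^ 2) = 1 / (1 + x ^ 2 * tanh c ^ 2)" for c
  proof -
    have c: "cosh c > 0" by simp
    have "cosh c ^ 2 - sin \<theta> ^ 2 = (cosh c ^ 2 + x ^ 2 * sinh c ^ 2) / (1 + x ^ 2)"
      using p by (simp add: sin2 cosh_square_eq field_simps)
    moreover have "cosh c ^ 2 + x ^ 2 * sinh c ^ 2 = cosh c ^ 2 * (1 + x ^ 2 * tanh c ^ 2)"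
      using c by (simp add: tanh_def field_simps)
    ultimately show ?thesis using p c by (simp add: cos2)
  qed
  with has_bochner_integral_kernel[OF \<theta>] show ?thesis
    by (simp add: mult.assoc sc) (simp add: \<theta>_def)
qed

text \<open>At x = 1 the representation has denominator \<open>1 + tanh c ^ 2\<close>, which is at
  most 2, so twice its integrand dominates the weight.\<close>

lemma integrable_weight: "integrable lborel (\<lambda>c::real. 1 / (pi ^ 2 / 4 + c ^ 2))"
proof (rule Bochner_Integration.integrable_bound)
  show "integrable lborel (\<lambda>c::real. 2 * (1 / (1 + 1 ^ 2 * tanh c ^ 2) / (pi ^ 2 / 4 + c ^ 2)))"
    using arctan_integral_representation[of 1]
    by (intro integrable_mult_right) (simp only: has_bochner_integral_iff zero_less_one)
  have "1 / (pi ^ 2 / 4 + c ^ 2) \<le> 2 * (1 / (1 + 1 ^ 2 * tanh c ^ 2) / (pi ^ 2 / 4 + c ^ 2))" for c :: real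
  proof -
    have "tanh c ^ 2 \<le> 1"
      using tanh_real_bounds[of c] by (simp add: abs_square_le_1 abs_le_iff)
    then have "1 \<le> 2 * (1 / (1 + 1 ^ 2 * tanh c ^ 2))"
      using add_pos_nonneg[of 1 "tanh c ^ 2"] by (simp add: field_simps)
    then have "1 / (pi ^ 2 / 4 + c ^ 2) \<le> 2 * (1 / (1 + 1 ^ 2 * tanh c ^ 2)) / (pi ^ 2 / 4 + c ^ 2)"
      by (rule divide_right_mono) simp
    then show ?thesis by (simp add: mult.assoc)
  qed
  moreover have "1 / (pi ^ 2 / 4 + c ^ 2) \<ge> 0" for c :: real by simp
  ultimately show "AE c in lborel. norm (1 / (pi ^ 2 / 4 + c ^ 2) :: real)
      \<le> norm (2 * (1 / (1 + 1 ^ 2 * tanh c ^ 2) / (pi ^ 2 / 4 + c ^ 2)))"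
    by (intro AE_I2) (metis abs_of_nonneg order_trans real_norm_def)
qed simp

text \<open>Here \<open>q = 1 / (a + i / t)\<close>, in a form that also covers \<open>t = 0\<close>.\<close>
lemma stieltjes_kernel_sums:
  fixes a h t :: real
  assumes h: "\<bar>h\<bar> < a"
  defines "q \<equiv> of_real t / Complex (a * t) 1"
  shows "(\<lambda>n. (1 / a ^ Suc n - Re (q ^ Suc n)) * h ^ n) sums (1 / ((a - h) * (1 + (a - h) ^ 2 * t ^ 2)))"
    and "\<bar>Re (q ^ Suc n)\<bar> \<le> 1 / a ^ Suc n"
proof -
  have a: "a > 0" using h by simp
  have nz: "Complex u 1 \<noteq> 0" for u by (simp add: complex_eq_iff)
  have "a * norm (of_real t :: complex) \<le> norm (Complex (a * t) 1)"
    using abs_Re_le_cmod[of "Complex (a * t) 1"] a by (simp add: abs_mult)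
  \<comment> \<open>This bound serves twice: it gives the sign of the coefficients and the
    convergence of the geometric series for \<open>\<bar>h\<bar> < a\<close>.\<close>
  then have q: "norm q \<le> 1 / a"
    using a nz by (simp add: q_def norm_divide field_simps)
  show "\<bar>Re (q ^ Suc n)\<bar> \<le> 1 / a ^ Suc n"
  proof -
    have "\<bar>Re (q ^ Suc n)\<bar> \<le> norm q ^ Suc n"
      using abs_Re_le_cmod[of "q ^ Suc n"] by (simp only: norm_power)
    also have "\<dots> \<le> (1 / a) ^ Suc n" by (rule power_mono[OF q]) auto
    finally show ?thesis by (simp add: power_divide)
  qed
  have "norm (q * of_real h) \<le> 1 / a * \<bar>h\<bar>"
    using q using a unfolding norm_mult by (intro mult_mono) auto
  also have "\<dots> < 1" using h a by (simp add: field_simps)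
  finally have "(\<lambda>n. (q * of_real h) ^ n) sums (1 / (1 - q * of_real h))"
    by (rule geometric_sums)
  then have "(\<lambda>n. q * (q * of_real h) ^ n) sums (q * (1 / (1 - q * of_real h)))"
    by (rule sums_mult)
  \<comment> \<open>Replacing a by a - h in the formula for \<open>q\<close>: for t nonzero this is
    1/((a - h) + i/t).\<close>
  moreover have "q * (1 / (1 - q * of_real h)) = of_real t / Complex ((a - h) * t) 1"
  proof -
    have "1 - q * of_real h = Complex ((a - h) * t) 1 / Complex (a * t) 1"
      using nz[of "a * t"] by (simp add: q_def field_simps) (simp add: complex_eq_iff algebra_simps)
    then show ?thesis using nz by (simp add: q_def)
  qed
  ultimately have "(\<lambda>n. q * (q * of_real h) ^ n) sums (of_real t / Complex ((a - h) * t) 1)" by simp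
  then have "(\<lambda>n. Re (q * (q * of_real h) ^ n)) sums Re (of_real t / Complex ((a - h) * t) 1)"
    by (rule sums_Re)
  moreover have "q * (q * of_real h) ^ n = q ^ Suc n * of_real (h ^ n)" for n
    by (simp add: power_mult_distrib)
  ultimately have 1: "(\<lambda>n. Re (q ^ Suc n) * h ^ n) sums ((a - h) * t ^ 2 / (((a - h) * t) ^ 2 + 1))"
    by (simp add: Re_divide power2_eq_square mult_ac del: power_Suc)
  have "(\<lambda>n. 1 / a * (h / a) ^ n) sums (1 / a * (1 / (1 - h / a)))"
    using h a by (intro sums_mult geometric_sums) auto
  then have 2: "(\<lambda>n. 1 / a ^ Suc n * h ^ n) sums (1 / (a - h))"
    using h a by (simp add: power_divide field_simps)
  \<comment> \<open>With X = a - h, this recombines the sums of the two geometric series into the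
    kernel.\<close>
  have "1 / X - X * t ^ 2 / ((X * t) ^ 2 + 1) = 1 / (X * (1 + X ^ 2 * t ^ 2))" if "X > 0" for X :: real
  proof -
    have p: "1 + X ^ 2 * t ^ 2 > 0" by (intro add_pos_nonneg) auto
    then have "1 / X - X * t ^ 2 / (1 + X ^ 2 * t ^ 2) = (1 + X ^ 2 * t ^ 2 - X * (X * t ^ 2)) / (X * (1 + X ^ 2 * t ^ 2))"
      using that by (simp add: diff_frac_eq)
    then show ?thesis by (simp add: power2_eq_square power_mult_distrib add.commute mult_ac)
  qed
  from this[of "a - h"] sums_diff[OF 2 1] h
  show "(\<lambda>n. (1 / a ^ Suc n - Re (q ^ Suc n)) * h ^ n) sums (1 / ((a - h) * (1 + (a - h) ^ 2 * t ^ 2)))"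
    by (simp add: left_diff_distrib del: power_Suc)
qed

section \<open>Signs of the derivatives, smoothness and conclusion\<close>

text \<open>The kernel expansion is integrated term by term against the weight. Its radius is
  \<open>a\<close>, the distance to 0, where a - h stays positive. The function is negated because
  it is the logarithmic derivative of 1/arctan.\<close>

lemma alternating_derivs_log_deriv_inverse_arctan:
  fixes a :: real
  assumes a: "a > 0"
  shows "(-1) ^ k * (deriv ^^ k) (\<lambda>x. - 1 / ((1 + x ^ 2) * arctan x)) a \<le> 0"
proof -
  define w where "w c = 1 / (pi ^ 2 / 4 + c ^ 2)" for c :: real
  define q where "q c = of_real (tanh c) / Complex (a * tanh c) 1" for c
  define b where "b n c = 1 / a ^ Suc n - Re (q c ^ Suc n)" for n c
  \<comment> \<open>The division by 2 removes the factor 2 of the integral representation.\<close>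
  define B where "B n = (\<integral>c. b n c * w c \<partial>lborel) / 2" for n
  have w: "w c \<ge> 0" for c by (simp add: w_def)
  have q: "\<bar>Re (q c ^ Suc n)\<bar> \<le> 1 / a ^ Suc n" for n c
    unfolding q_def using a by (intro stieltjes_kernel_sums(2)[of 0]) simp
  have b: "0 \<le> b n c" "b n c \<le> 2 / a ^ Suc n" for n c
    using q[of c n] by (auto simp: b_def)
  have cont_q: "continuous_on UNIV q"
    unfolding q_def by (auto simp: Complex_eq complex_eq_iff intro!: continuous_intros)
  have [measurable]: "b n \<in> borel_measurable borel" for n
    unfolding b_def by (intro borel_measurable_continuous_onI continuous_intros cont_q)
  have [measurable]: "w \<in> borel_measurable borel" unfolding w_def by measurable
  have int_w: "integrable lborel w" using integrable_weight by (simp add: w_def[abs_def])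
  have int: "integrable lborel (\<lambda>c. b n c * w c)" for n
  proof (rule Bochner_Integration.integrable_bound)
    show "integrable lborel (\<lambda>c. 2 / a ^ Suc n * w c)" using int_w by simp
    have "norm (b n c * w c) \<le> norm (2 / a ^ Suc n * w c)" for c
    proof -
      have "0 \<le> b n c * w c" "b n c * w c \<le> 2 / a ^ Suc n * w c"
        by (intro mult_nonneg_nonneg mult_right_mono b w)+
      then show ?thesis unfolding real_norm_def by linarith
    qed
    then show "AE c in lborel. norm (b n c * w c) \<le> norm (2 / a ^ Suc n * w c)" by simp
  qed measurable
  have "B n \<ge> 0" for n
    using b w by (auto simp: B_def intro!: integral_nonneg_AE)
  moreover have "(\<lambda>n. B n * h ^ n) sums (1 / ((1 + (a - h) ^ 2) * arctan (a - h)))" if h: "\<bar>h\<bar> < a" for h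
  proof -
    let ?f = "\<lambda>n c. b n c * h ^ n * w c"
    \<comment> \<open>A convergent geometric series times an integrable weight: this justifies
      exchanging sum and integral.\<close>
    have bound: "norm (?f n c) \<le> 2 / a * (\<bar>h\<bar> / a) ^ n * w c" for n c
    proof -
      have "norm (?f n c) = b n c * (\<bar>h\<bar> ^ n * w c)" using b[of n c] w by (simp add: abs_mult power_abs)
      also have "\<dots> \<le> 2 / a ^ Suc n * (\<bar>h\<bar> ^ n * w c)" by (intro mult_right_mono b) (simp add: w)
      finally show ?thesis by (simp add: power_divide)
    qed
    have geo: "summable (\<lambda>n. 2 / a * (\<bar>h\<bar> / a) ^ n * r)" for r
      using h a by (intro summable_mult summable_mult2 summable_geometric) auto
    have int_f: "integrable lborel (?f n)" for n
      using integrable_mult_right[OF int[of n], of "h ^ n"] by (simp add: mult_ac)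
    have "(\<lambda>n. \<integral>c. ?f n c \<partial>lborel) sums (\<integral>c. (\<Sum>n. ?f n c) \<partial>lborel)"
    proof (rule sums_integral[OF int_f])
      show "AE c in lborel. summable (\<lambda>n. norm (?f n c))"
        using bound by (intro AE_I2 summable_comparison_test'[OF geo]) auto
      have "norm (\<integral>c. norm (?f n c) \<partial>lborel) \<le> 2 / a * (\<bar>h\<bar> / a) ^ n * (\<integral>c. w c \<partial>lborel)" for n
      proof -
        have "(\<integral>c. norm (?f n c) \<partial>lborel) \<le> (\<integral>c. 2 / a * (\<bar>h\<bar> / a) ^ n * w c \<partial>lborel)"
          by (intro integral_mono integrable_norm int_f bound integrable_mult_right int_w)
        then show ?thesis by simp
      qed
      then show "summable (\<lambda>n. \<integral>c. norm (?f n c) \<partial>lborel)"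
        by (intro summable_comparison_test'[OF geo]) auto
    qed
    \<comment> \<open>The kernel expansion at \<open>t = tanh c\<close> gives the integrand of the
      representation at a - h, divided by a - h.\<close>
    moreover have "(\<Sum>n. ?f n c) = 1 / (a - h) * (1 / (1 + (a - h) ^ 2 * tanh c ^ 2) / (pi ^ 2 / 4 + c ^ 2))" for c
      using sums_mult2[OF stieltjes_kernel_sums(1)[OF h, of "tanh c"], of "w c"]
      by (simp add: sums_iff b_def q_def w_def)
    moreover have "(\<integral>c. ?f n c \<partial>lborel) = 2 * (B n * h ^ n)" for n
    proof -
      have "(\<integral>c. ?f n c \<partial>lborel) = (\<integral>c. h ^ n * (b n c * w c) \<partial>lborel)" by (simp add: mult_ac)
      then show ?thesis by (simp add: B_def)
    qed
    moreover have "(\<integral>c. 1 / (a - h) * (1 / (1 + (a - h) ^ 2 * tanh c ^ 2) / (pi ^ 2 / 4 + c ^ 2)) \<partial>lborel)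
        = 2 * (1 / ((1 + (a - h) ^ 2) * arctan (a - h)))"
    proof -
      have X: "a - h > 0" using h by simp
      have "(\<integral>c. 1 / (1 + (a - h) ^ 2 * tanh c ^ 2) / (pi ^ 2 / 4 + c ^ 2) \<partial>lborel)
          = 2 * (a - h) / ((1 + (a - h) ^ 2) * arctan (a - h))"
        using arctan_integral_representation[OF X] by (rule has_bochner_integral_integral_eq)
      then show ?thesis using X by (simp only: integral_mult_right_zero) (simp del: right_diff_distrib_numeral)
    qed
    ultimately show ?thesis by (simp only: sums_mult_iff[of "2::real", simplified])
  qed
  ultimately show ?thesis
    by (intro powser_alternating_derivs[OF a, of "\<lambda>n. - B n"]) (auto dest: sums_minus)
qed

text \<open>The extension 1/Arctan is holomorphic on the right half-plane: the branch cuts lie on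
  the imaginary axis, and a zero of Arctan would force z = tan 0 = 0.\<close>

lemma inverse_arctan_smooth:
  fixes x :: real
  assumes "x > 0"
  shows "(deriv ^^ n) (\<lambda>x. 1 / arctan x) differentiable (at x)"
proof (rule Re_higher_deriv(2))
  show "open {z::complex. Re z > 0}" by (rule open_halfspace_Re_gt)
  have "Arctan z \<noteq> 0" if "Re z > 0" for z
  proof
    assume "Arctan z = 0"
    \<comment> \<open>The points i and -i, where tan does not invert Arctan, have real part
      0.\<close>
    moreover have "z ^ 2 \<noteq> - 1"
    proof
      assume "z ^ 2 = - 1"
      then have "(z - \<i>) * (z + \<i>) = 0" by (simp add: algebra_simps power2_eq_square)
      with that show False by (auto simp: eq_neg_iff_add_eq_0[symmetric])
    qed
    ultimately have "z = 0" using tan_Arctan[of z] by simp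
    with that show False by simp
  qed
  then show "(\<lambda>z. 1 / Arctan z) holomorphic_on {z. Re z > 0}"
    by (intro holomorphic_intros holomorphic_on_Arctan) auto
  show "1 / arctan x = Re (1 / Arctan (of_real x))" for x
    by (simp add: Arctan_of_real flip: of_real_divide)
qed (use assms in simp)

theorem theorem2p1:
  shows "logarithmically_completely_monotonic (\<lambda>x::real. 1 / arctan x)"
  unfolding logarithmically_completely_monotonic_def infinitely_differentiable_on_pos_def
proof (intro conjI allI impI)
  fix n :: nat and x :: real
  assume n: "1 \<le> n" and x: "0 < x"
  let ?g = "\<lambda>x. - 1 / ((1 + x ^ 2) * arctan x)"
  \<comment> \<open>One derivative is spent on passing from the logarithm to \<open>?g\<close>; the
    remaining sign (-1)^n = -(-1)^k turns \<open>\<le> 0\<close> for \<open>?g\<close> into the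
    claim.\<close>
  from n obtain k where k: "n = Suc k" by (cases n) auto
  have "deriv (\<lambda>t. ln (1 / arctan t)) y = ?g y" if "y > 0" for y
  proof (rule DERIV_imp_deriv)
    have "1 + y ^ 2 > 0" by (intro add_pos_nonneg) auto
    with that show "((\<lambda>t. ln (1 / arctan t)) has_field_derivative ?g y) (at y)"
      by (auto intro!: derivative_eq_intros simp: divide_simps power2_eq_square)
  qed
  \<comment> \<open>The first derivative is known only on the positive half-line; as this is open,
    the two functions agree near \<open>x\<close>, which suffices for all further
    derivatives.\<close>
  then have "(deriv ^^ n) (\<lambda>t. ln (1 / arctan t)) x = (deriv ^^ k) ?g x"
    unfolding k funpow_Suc_right comp_def using x
    by (intro higher_deriv_cong_ev) (auto simp: eventually_nhds intro!: exI[of _ "{0<..}"])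
  then show "0 \<le> (-1) ^ n * (deriv ^^ n) (\<lambda>t. ln (1 / arctan t)) x"
    using alternating_derivs_log_deriv_inverse_arctan[OF x, of k] by (simp add: k)
qed (use inverse_arctan_smooth in auto)

end
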